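(* Let $u$ be a positive integer (a one-letter word), and let $n\ge0$, $m\ge1$ be integers. Then $$c_{n,m}(u)=\begin{cases} c_{n,m}(1) & \text{if } u\le m,\\ \delta_{n,0} & \text{if } u>m,\end{cases}$$ where $\delta_{n,0}$ is $1$ if $n=0$ and $0$ otherwise.
   Context: For a word $u$ over the positive integers, $C(u)=\{w \mid uw\equiv wu\}$ with $\equiv$ Knuth equivalence (equivalently $P(uw)=P(wu)$ for RSK insertion tableaux), and $c_{n,m}(u)=\#\{w\in C(u) \mid w \text{ has length } n \text{ and } \max w\le m\}$, i.e. the number of $w\in\{1,\ldots,m\}^n$ with $uw\equiv wu$ (the empty word counts for $n=0$). *)

theory Defs
  imports Main
begin

definition is_word :: "nat list \<Rightarrow> bool" where
  "is_word w \<longleftrightarrow> (\<forall>a\<in>set w. 1 \<le> a)"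

text \<open>
  One elementary Knuth transformation, applied inside an arbitrary context. The strict and weak
  inequalities are those matching row insertion, where a letter bumps the leftmost entry that is
  strictly larger than it.
\<close>

inductive knuth_step :: "nat list \<Rightarrow> nat list \<Rightarrow> bool" where
  yzx_yxz: "x < y \<Longrightarrow> y \<le> z \<Longrightarrow> knuth_step (p @ [y, z, x] @ q) (p @ [y, x, z] @ q)"
| xzy_zxy: "x \<le> y \<Longrightarrow> y < z \<Longrightarrow> knuth_step (p @ [x, z, y] @ q) (p @ [z, x, y] @ q)"

text \<open>
  Elementary transformations only permute letters, so for words over the positive integers the
  intermediate lists of this closure are again such words.
\<close>

definition knuth_equiv :: "nat list \<Rightarrow> nat list \<Rightarrow> bool"  (infix "\<equiv>\<^sub>K" 50) where
  "knuth_equiv = equivclp knuth_step"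

definition knuth_centralizer :: "nat list \<Rightarrow> nat list set" where
  "knuth_centralizer u = {w. is_word w \<and> u @ w \<equiv>\<^sub>K w @ u}"

text \<open>
  The condition that the maximum of w is at most m is stated letterwise, so that the empty word
  satisfies it. The counted set is finite, so \<open>card\<close> is the true cardinality.
\<close>

definition centralizer_count :: "nat \<Rightarrow> nat \<Rightarrow> nat list \<Rightarrow> nat" where
  "centralizer_count n m u =
     card {w \<in> knuth_centralizer u. length w = n \<and> (\<forall>a\<in>set w. a \<le> m)}"

end

theory Submission
  imports Defs
begin

text \<open>
  Read \<open>i + 1\<close> as an opening and \<open>i\<close> as a closing bracket. Replacing every unmatched \<open>i\<close> by \<open>i + 1\<close>
  (the highest power of a crystal operator) respects Knuth equivalence, and so does the number of
  unmatched \<open>i + 1\<close>. Comparing that number in \<open>iw\<close> and \<open>wi\<close> shows that a word \<open>w\<close> commuting with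
  \<open>i\<close> has no unmatched \<open>i + 1\<close>; hence the replacement turns \<open>iw\<close> into \<open>(i + 1)w'\<close> and \<open>wi\<close> into
  \<open>w'(i + 1)\<close> with the same \<open>w'\<close>, and \<open>w \<mapsto> w'\<close> is injective. So the counts increase weakly from
  \<open>1\<close> to \<open>m\<close>, while reversing words and complementing letters exchanges the commutants of \<open>1\<close> and
  \<open>m\<close>, so that they are all equal.

  If \<open>u\<close> exceeds all letters of a nonempty \<open>w\<close>, matching \<open>u\<close> with the largest letter of \<open>w\<close> leaves
  the last letter of \<open>wu\<close> unmatched but none in \<open>uw\<close>.
\<close>

section \<open>Lifting invariants from Knuth steps to Knuth equivalence\<close>

lemma knuth_step_set: "knuth_step w w' \<Longrightarrow> set w' = set w"
  by (induction rule: knuth_step.induct) auto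

lemma knuth_equiv_step: "knuth_step w w' \<Longrightarrow> w \<equiv>\<^sub>K w'"
  unfolding knuth_equiv_def by blast

lemma equivp_knuth_equiv: "equivp (\<equiv>\<^sub>K)"
  unfolding knuth_equiv_def by (rule equivp_evquivclp)

lemma knuth_equiv_sym: "w \<equiv>\<^sub>K w' \<Longrightarrow> w' \<equiv>\<^sub>K w"
  using equivp_knuth_equiv by (rule equivp_symp)

text \<open>Steps preserve the set of letters, so the bound \<open>A\<close> on the starting word
  persists along the whole chain.\<close>

lemma knuth_equiv_lift:
  assumes "w \<equiv>\<^sub>K w'" and "set w \<subseteq> A" and "equivp R"
    and step: "\<And>v v'. knuth_step v v' \<Longrightarrow> set v \<subseteq> A \<Longrightarrow> R (f v) (f v')"
  shows "R (f w) (f w')"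
proof -
  have "set w' \<subseteq> A \<and> R (f w) (f w')"
    using assms(1) unfolding knuth_equiv_def
  proof (induction rule: equivclp_induct)
    case base
    then show ?case using assms(2,3) by (simp add: equivp_reflp)
  next
    case (step y z)
    then have "R (f y) (f z)"
      using assms(4) knuth_step_set equivp_symp[OF assms(3)] by metis
    then show ?case
      using step knuth_step_set equivp_transp[OF assms(3)] by metis
  qed
  then show ?thesis ..
qed

section \<open>Bracket matching and the crystal operator\<close>

text \<open>
  The argument \<open>d\<close> counts the letters \<open>j\<close> that are still open when the scan of the word starts.
\<close>

fun open_count :: "nat \<Rightarrow> nat \<Rightarrow> nat \<Rightarrow> nat list \<Rightarrow> nat" where
  "open_count i j d [] = d"
| "open_count i j d (a # w) =
     open_count i j (if a = j then Suc d else if a = i then d - 1 else d) w"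

fun raise_unmatched :: "nat \<Rightarrow> nat \<Rightarrow> nat \<Rightarrow> nat list \<Rightarrow> nat list" where
  "raise_unmatched i j d [] = []"
| "raise_unmatched i j d (a # w) =
     (if a = i \<and> d = 0 then j else a) #
     raise_unmatched i j (if a = j then Suc d else if a = i then d - 1 else d) w"

lemma open_count_append:
  "open_count i j d (v @ w) = open_count i j (open_count i j d v) w"
  by (induction v arbitrary: d) simp_all

lemma raise_unmatched_append:
  "raise_unmatched i j d (v @ w) = raise_unmatched i j d v @ raise_unmatched i j (open_count i j d v) w"
  by (induction v arbitrary: d) simp_all

lemma length_raise_unmatched [simp]: "length (raise_unmatched i j d w) = length w"
  by (induction w arbitrary: d) simp_all

lemma set_raise_unmatched: "set (raise_unmatched i j d w) \<subseteq> insert j (set w)"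
  by (induction w arbitrary: d) (auto split: if_splits)

text \<open>Only a swap of \<open>i\<close> with \<open>j\<close> matters. As no letter lies
  strictly between them, the words compared are then \<open>jji\<close> and \<open>jij\<close>, or
  \<open>iji\<close> and \<open>jii\<close>, and these leave equally many brackets open.\<close>

lemma open_count_knuth_step:
  assumes "knuth_step w w'" and "set w \<subseteq> {..i} \<union> {j..}" and "i < j"
  shows "open_count i j d w = open_count i j d w'"
  using assms by (induction rule: knuth_step.induct) (auto simp: open_count_append)

lemma raise_unmatched_knuth_step:
  assumes "knuth_step w w'" and "set w \<subseteq> {..i} \<union> {j..}" and "i < j"
  shows "raise_unmatched i j d w \<equiv>\<^sub>K raise_unmatched i j d w'"
  using assms
proof (induction rule: knuth_step.induct)
  case (yzx_yxz x y z p q)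
  let ?e = "open_count i j d p"
  have same: "open_count i j ?e [y, z, x] = open_count i j ?e [y, x, z]"
    using yzx_yxz by auto
  obtain x' y' z' where eq: "raise_unmatched i j ?e [y, z, x] = [y', z', x']"
    by simp
  then have less: "x' < y'" "y' \<le> z'" and eq': "raise_unmatched i j ?e [y, x, z] = [y', x', z']"
    using yzx_yxz by (auto split: if_splits)
  show ?case
    unfolding raise_unmatched_append eq eq' same
    by (rule knuth_equiv_step[OF knuth_step.yzx_yxz[OF less]])
next
  case (xzy_zxy x y z p q)
  let ?e = "open_count i j d p"
  have same: "open_count i j ?e [x, z, y] = open_count i j ?e [z, x, y]"
    using xzy_zxy by auto
  show ?case
  \<comment> \<open>With nothing open, \<open>iji\<close> becomes \<open>jji\<close> but
    \<open>jii\<close> becomes \<open>jij\<close>: the images are related by the other kind of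
    step.\<close>
  proof (cases "x = i \<and> y = i \<and> z = j \<and> ?e = 0")
    case True
    then have eq: "raise_unmatched i j ?e [x, z, y] = [j, j, i]"
      and eq': "raise_unmatched i j ?e [z, x, y] = [j, i, j]"
      using \<open>i < j\<close> by auto
    show ?thesis
      unfolding raise_unmatched_append eq eq' same
      by (rule knuth_equiv_step[OF knuth_step.yzx_yxz[OF \<open>i < j\<close> order_refl]])
  next
    case False
    obtain x' y' z' where eq: "raise_unmatched i j ?e [x, z, y] = [x', z', y']"
      by simp
    then have less: "x' \<le> y'" "y' < z'"
      and eq': "raise_unmatched i j ?e [z, x, y] = [z', x', y']"
      using False xzy_zxy by (auto split: if_splits)
    show ?thesis
      unfolding raise_unmatched_append eq eq' same
      by (rule knuth_equiv_step[OF knuth_step.xzy_zxy[OF less]])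
  qed
qed

lemma open_count_knuth_equiv:
  assumes "w \<equiv>\<^sub>K w'" and "set w \<subseteq> {..i} \<union> {j..}" and "i < j"
  shows "open_count i j d w = open_count i j d w'"
  by (rule knuth_equiv_lift[OF assms(1,2) identity_equivp])
    (rule open_count_knuth_step[OF _ _ assms(3)])

lemma raise_unmatched_knuth_equiv:
  assumes "w \<equiv>\<^sub>K w'" and "set w \<subseteq> {..i} \<union> {j..}" and "i < j"
  shows "raise_unmatched i j d w \<equiv>\<^sub>K raise_unmatched i j d w'"
  by (rule knuth_equiv_lift[OF assms(1,2) equivp_knuth_equiv])
    (rule raise_unmatched_knuth_step[OF _ _ assms(3)])

text \<open>
  Scanning from the right, the output letter and the number of open brackets after it determine
  the input letter and the number of open brackets before it.
\<close>

lemma raise_unmatched_inject: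
  assumes "raise_unmatched i j d v = raise_unmatched i j d w"
    and "open_count i j d v = open_count i j d w" and "i \<noteq> j"
  shows "v = w"
  using assms
proof (induction v arbitrary: w rule: rev_induct)
  case Nil
  then show ?case by (metis length_raise_unmatched length_0_conv)
next
  case (snoc a v)
  then obtain b w' where w: "w = w' @ [b]"
    by (metis length_raise_unmatched length_0_conv rev_exhaust snoc_eq_iff_butlast)
  \<comment> \<open>A last output \<open>j\<close> comes from \<open>j\<close> if the final count is
    positive, and from an unmatched \<open>i\<close> if it is 0.\<close>
  have "a = b" "open_count i j d v = open_count i j d w'"
    using snoc.prems unfolding w
    by (auto simp: raise_unmatched_append open_count_append split: if_splits)
  then show ?case
    using snoc.prems snoc.IH[of w'] unfolding w by (simp add: raise_unmatched_append)
qed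

section \<open>Commutants of neighbouring letters\<close>

definition bounded_centralizer :: "nat \<Rightarrow> nat \<Rightarrow> nat \<Rightarrow> nat list set" where
  "bounded_centralizer n m u =
     {w. set w \<subseteq> {1..m} \<and> length w = n \<and> u # w \<equiv>\<^sub>K w @ [u]}"

lemma centralizer_count_eq: "centralizer_count n m [u] = card (bounded_centralizer n m u)"
  unfolding centralizer_count_def bounded_centralizer_def knuth_centralizer_def is_word_def
  by (rule arg_cong[where f = card]) auto

lemma finite_bounded_centralizer: "finite (bounded_centralizer n m u)"
  unfolding bounded_centralizer_def
  by (rule finite_subset[OF _ finite_lists_length_eq[of "{1..m}" n]]) auto

text \<open>A leading \<open>i\<close> is unmatched and changes nothing, while a final
  \<open>i\<close> lowers the count \<open>c\<close> of \<open>w\<close> to \<open>c - 1\<close>;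
  equality forces \<open>c = 0\<close>.\<close>

lemma centralizer_open_count:
  assumes "i # w \<equiv>\<^sub>K w @ [i]"
  shows "open_count i (Suc i) 0 w = 0"
proof -
  have "open_count i (Suc i) 0 (i # w) = open_count i (Suc i) 0 (w @ [i])"
    using assms by (rule open_count_knuth_equiv) auto
  then show ?thesis by (simp add: open_count_append)
qed

lemma raise_unmatched_centralizer:
  assumes "i # w \<equiv>\<^sub>K w @ [i]"
  shows "Suc i # raise_unmatched i (Suc i) 0 w \<equiv>\<^sub>K raise_unmatched i (Suc i) 0 w @ [Suc i]"
proof -
  have "raise_unmatched i (Suc i) 0 (i # w) \<equiv>\<^sub>K raise_unmatched i (Suc i) 0 (w @ [i])"
    using assms by (rule raise_unmatched_knuth_equiv) auto
  then show ?thesis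
    using centralizer_open_count[OF assms] by (simp add: raise_unmatched_append)
qed

lemma card_bounded_centralizer_Suc:
  assumes "Suc i \<le> m"
  shows "card (bounded_centralizer n m i) \<le> card (bounded_centralizer n m (Suc i))"
proof (rule card_inj_on_le)
  let ?f = "raise_unmatched i (Suc i) 0"
  show "inj_on ?f (bounded_centralizer n m i)"
    \<comment> \<open>The final count is 0 on the whole commutant, so the outputs alone determine
      the words.\<close>
    by (auto simp: inj_on_def bounded_centralizer_def centralizer_open_count
        intro: raise_unmatched_inject)
  have "set (?f w) \<subseteq> {1..m}" if "set w \<subseteq> {1..m}" for w
    using that assms set_raise_unmatched[of i "Suc i" 0 w] by fastforce
  then show "?f ` bounded_centralizer n m i \<subseteq> bounded_centralizer n m (Suc i)"
    by (auto simp: bounded_centralizer_def raise_unmatched_centralizer)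
qed (rule finite_bounded_centralizer)

lemma card_bounded_centralizer_mono:
  assumes "i \<le> k" and "k \<le> m"
  shows "card (bounded_centralizer n m i) \<le> card (bounded_centralizer n m k)"
  using assms by (induction rule: dec_induct) (auto intro: order_trans card_bounded_centralizer_Suc)

section \<open>Reversal and complement\<close>

definition rev_compl :: "nat \<Rightarrow> nat list \<Rightarrow> nat list" where
  "rev_compl N w = rev (map (\<lambda>a. N - a) w)"

text \<open>Reversing both positions and the order of letters exchanges the two kinds of
  step.\<close>

lemma rev_compl_knuth_step:
  assumes "knuth_step w w'" and "set w \<subseteq> {..N}"
  shows "knuth_step (rev_compl N w') (rev_compl N w)"
  using assms
proof (induction rule: knuth_step.induct)
  case (yzx_yxz x y z p q)
  then have "N - z \<le> N - y" "N - y < N - x"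
    by auto
  then show ?case
    using knuth_step.xzy_zxy[of "N - z" "N - y" "N - x" "rev_compl N q" "rev_compl N p"]
    by (simp add: rev_compl_def)
next
  case (xzy_zxy x y z p q)
  then have "N - z < N - y" "N - y \<le> N - x"
    by auto
  then show ?case
    using knuth_step.yzx_yxz[of "N - z" "N - y" "N - x" "rev_compl N q" "rev_compl N p"]
    by (simp add: rev_compl_def)
qed

lemma rev_compl_knuth_equiv:
  assumes "w \<equiv>\<^sub>K w'" and "set w \<subseteq> {..N}"
  shows "rev_compl N w \<equiv>\<^sub>K rev_compl N w'"
  by (rule knuth_equiv_lift[OF assms equivp_knuth_equiv])
    (rule knuth_equiv_sym[OF knuth_equiv_step[OF rev_compl_knuth_step]])

lemma rev_compl_rev_compl:
  assumes "set w \<subseteq> {..N}"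
  shows "rev_compl N (rev_compl N w) = w"
  unfolding rev_compl_def rev_map map_map rev_rev_ident
  by (rule map_idI) (use assms in auto)

lemma card_bounded_centralizer_compl:
  assumes "u \<le> Suc m"
  shows "card (bounded_centralizer n m u) \<le> card (bounded_centralizer n m (Suc m - u))"
proof (rule card_inj_on_le)
  let ?f = "rev_compl (Suc m)"
  show "inj_on ?f (bounded_centralizer n m u)"
  proof (rule inj_on_inverseI)
    fix w assume "w \<in> bounded_centralizer n m u"
    then show "?f (?f w) = w"
      by (intro rev_compl_rev_compl) (auto simp: bounded_centralizer_def)
  qed
  show "?f ` bounded_centralizer n m u \<subseteq> bounded_centralizer n m (Suc m - u)"
  proof
    fix v assume "v \<in> ?f ` bounded_centralizer n m u"
    then obtain w where v: "v = ?f w" and w: "set w \<subseteq> {1..m}" "length w = n" "u # w \<equiv>\<^sub>K w @ [u]"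
      by (auto simp: bounded_centralizer_def)
    have "?f (u # w) \<equiv>\<^sub>K ?f (w @ [u])"
      using w assms by (intro rev_compl_knuth_equiv) auto
    then have "(Suc m - u) # v \<equiv>\<^sub>K v @ [Suc m - u]"
      unfolding v by (auto simp: rev_compl_def intro: knuth_equiv_sym)
    then show "v \<in> bounded_centralizer n m (Suc m - u)"
      using w unfolding v by (fastforce simp: bounded_centralizer_def rev_compl_def)
  qed
qed (rule finite_bounded_centralizer)

section \<open>Letters beyond the bound\<close>

lemma open_count_le: "j \<notin> set w \<Longrightarrow> open_count i j d w \<le> d"
proof (induction w arbitrary: d)
  case (Cons a w)
  then show ?case
    using Cons.IH[of d] le_trans[OF Cons.IH[of "d - 1"] diff_le_self] by simp
qed simp

lemma open_count_less: "j \<notin> set w \<Longrightarrow> i \<in> set w \<Longrightarrow> 0 < d \<Longrightarrow> open_count i j d w < d"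
proof (induction w arbitrary: d)
  case (Cons a w)
  then show ?case
    using open_count_le[of j w i "d - 1"] by (cases "a = i") auto
qed simp

lemma bounded_centralizer_large:
  assumes "m < u"
  shows "bounded_centralizer n m u = (if n = 0 then {[]} else {})"
proof -
  have "w = []" if "set w \<subseteq> {1..m}" "u # w \<equiv>\<^sub>K w @ [u]" for w
  proof (rule ccontr)
    assume "w \<noteq> []"
    \<comment> \<open>The maximum is chosen so that no letter of \<open>w\<close> lies strictly
      between \<open>i\<close> and \<open>u\<close>.\<close>
    define i where "i = Max (set w)"
    have i: "i \<in> set w" and le: "\<And>a. a \<in> set w \<Longrightarrow> a \<le> i"
      using \<open>w \<noteq> []\<close> by (simp_all add: i_def)
    have "i < u" and notin: "u \<notin> set w"
      using i that(1) assms by auto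
    then have "open_count i u 0 (u # w) = open_count i u 0 (w @ [u])"
      using that(2) le by (intro open_count_knuth_equiv) auto
    \<comment> \<open>In \<open>u # w\<close> some \<open>i\<close> closes the only open bracket,
      whereas the last letter of \<open>w @ [u]\<close> stays open.\<close>
    then show False
      using open_count_less[OF notin i, of 1] by (simp add: open_count_append)
  qed
  then show ?thesis
    using equivp_reflp[OF equivp_knuth_equiv] by (auto simp: bounded_centralizer_def)
qed

theorem theorem5p1:
  fixes u n m :: nat
  assumes "1 \<le> u" and "1 \<le> m"
  shows "centralizer_count n m [u] =
    (if u \<le> m then centralizer_count n m [1] else if n = 0 then 1 else 0)"
proof (cases "u \<le> m")
  case True
  have "card (bounded_centralizer n m 1) \<le> card (bounded_centralizer n m u)"
    and "card (bounded_centralizer n m u) \<le> card (bounded_centralizer n m m)"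
    using True assms by (auto intro: card_bounded_centralizer_mono)
  \<comment> \<open>The complement takes \<open>m\<close> back to 1 and closes the cycle of
    inequalities.\<close>
  moreover have "card (bounded_centralizer n m m) \<le> card (bounded_centralizer n m 1)"
    using card_bounded_centralizer_compl[of m m n] by simp
  ultimately show ?thesis
    using True by (simp add: centralizer_count_eq)
next
  case False
  then show ?thesis
    by (simp add: centralizer_count_eq bounded_centralizer_large)
qed

end
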